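(* Let $A$ be an order of $\mathbb{Z}$-rank $n \ge 1$, and let $\ell$ be a prime number with $\ell > n^2$. Then there exists a maximal ideal $\mathfrak{p}$ of $A$ that contains a prime number $p \le 4(1+(\log n)^2)$ and that satisfies $\#(A/\mathfrak{p}) \not\equiv 1\bmod{\ell}$.
   Context: An order is a commutative ring whose additive group is isomorphic to $\mathbb{Z}^n$ for some $n\in\mathbb{Z}_{\ge0}$, called its $\mathbb{Z}$-rank. $\log$ denotes the natural logarithm. *)

theory Defs
  imports Complex_Main "HOL-Algebra.Algebra" "HOL-Number_Theory.Number_Theory"
begin

(* The free abelian group Z^n is the product of the groups indexed by {..<n}.
   For n = 0 the trivial ring is included.  "order" is already taken in the library
   (type class of partial orders, cardinality of a group). *)
definition order_of_rank :: "('a, 'b) ring_scheme \<Rightarrow> nat \<Rightarrow> bool" where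
  "order_of_rank A n \<longleftrightarrow>
     cring A \<and> add_monoid A \<cong> product_group {..<n} (\<lambda>_. integer_group)"

end

theory Submission
  imports Defs
begin

text \<open>
  If every maximal ideal of \<open>A\<close> containing a prime number \<open>p\<close> has norm congruent to 1 modulo \<open>l\<close>,
  then the finite ring \<open>A / pA\<close>, whose composition factors are residue fields of this kind, has
  cardinality \<open>p^n\<close> congruent to 1 modulo \<open>l\<close>. So if the theorem fails, every prime
  \<open>p \<le> 4 (1 + (ln n)\<^sup>2)\<close> is an \<open>n\<close>-th root of unity modulo \<open>l\<close>, and there are at most \<open>n\<close> of these.
  Let \<open>N\<close> be at most this bound, with \<open>N ^ j \<le> n\<close>. The quotients \<open>a / b\<close> of coprime products of \<open>j\<close>
  distinct primes \<open>\<le> N\<close> are pairwise distinct modulo \<open>l\<close>, because \<open>a b' \<le> n\<^sup>2 < l\<close>. With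
  \<open>\<pi>\<close> primes up to \<open>N\<close> this gives \<open>(\<pi> choose j) ((\<pi> - j) choose j) \<le> n\<close>, which contradicts Chebyshev's
  lower bound for \<open>\<pi>\<close> when \<open>N\<close> and \<open>j\<close> are chosen well.
\<close>

subsection \<open>A Chebyshev bound for the number of primes\<close>

definition primes_upto_set :: "nat \<Rightarrow> nat set" where
  "primes_upto_set N = {p. Factorial_Ring.prime p \<and> p \<le> N}"

lemma finite_primes_upto_set [simp]: "finite (primes_upto_set N)"
  unfolding primes_upto_set_def by (rule finite_subset[of _ "{..N}"]) auto

text \<open>
  In the form \<open>D / (m (N choose m)) \<in> \<int>\<close> the induction step is the recurrence of Leibniz's harmonic
  triangle: \<open>1 / ((m + 1) (N choose (m + 1))) = 1 / (m ((N - 1) choose m)) - 1 / (m (N choose m))\<close>.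
\<close>

lemma mult_binomial_dvd:
  fixes D :: int
  assumes "1 \<le> m" "m \<le> N" "\<And>k. 1 \<le> k \<Longrightarrow> k \<le> N \<Longrightarrow> int k dvd D"
  shows "int (m * (N choose m)) dvd D"
  using assms
proof (induction m arbitrary: N rule: nat_induct_at_least)
  case base
  then show ?case by simp
next
  case (Suc m)
  obtain M where N: "N = Suc M" using Suc.prems(1) by (cases N) auto
  obtain u where u: "D = int (m * (N choose m)) * u"
    using Suc.IH[of N] Suc.prems by (auto elim: dvdE)
  obtain v where v: "D = int (m * (M choose m)) * v"
    using Suc.IH[of M] Suc.prems N by (auto elim: dvdE)
  have pos: "M choose m > 0" "N choose m > 0" "N choose Suc m > 0" "m > 0"
    using Suc.prems Suc.hyps N by auto
  have e2: "(N - m) * (N choose m) = N * (M choose m)"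
    using binomial_absorb_comp[of N m] N by simp
  have e1: "Suc m * (N choose Suc m) = (N - m) * (N choose m)"
    using Suc_times_binomial_eq[of M m] e2 N by (metis mult.commute)
  have "real_of_int D = real (Suc m * (N choose Suc m)) * (real_of_int v - real_of_int u)"
  proof -
    have a: "real_of_int D = real m * real (N choose m) * real_of_int u"
      using arg_cong[OF u, of real_of_int] by simp
    have b: "real_of_int D = real m * real (M choose m) * real_of_int v"
      using arg_cong[OF v, of real_of_int] by simp
    have c: "(real N - real m) * real (N choose m) = real N * real (M choose m)"
      using arg_cong[OF e2, of real] Suc.prems by (simp add: of_nat_diff)
    have d: "real (Suc m * (N choose Suc m)) = (real N - real m) * real (N choose m)"
      using arg_cong[OF e1, of real] Suc.prems by (simp add: of_nat_diff)
    have "real m * (real (Suc m * (N choose Suc m)) * (real_of_int v - real_of_int u)) =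
        real N * (real m * real (M choose m) * real_of_int v) -
        (real N - real m) * (real m * real (N choose m) * real_of_int u)"
      unfolding d right_diff_distrib using c by (simp add: algebra_simps)
    also have "\<dots> = real m * real_of_int D"
      unfolding a[symmetric] b[symmetric] by (simp add: algebra_simps)
    finally show ?thesis using pos by simp
  qed
  then have "real_of_int D = real_of_int (int (Suc m * (N choose Suc m)) * (v - u))"
    by simp
  then have "D = int (Suc m * (N choose Suc m)) * (v - u)"
    by (simp only: of_int_eq_iff)
  then show ?case by (metis dvd_triv_left)
qed

text \<open>By \<open>mult_binomial_dvd\<close> both \<open>m * ?c\<close> and
  \<open>Suc m * ((2 * m + 1) choose Suc m) = (2 * m + 1) * ?c\<close> divide the lcm. Since
  \<open>m\<close> and \<open>2 * m + 1\<close> are coprime, \<open>m * (2 * m + 1) * ?c\<close>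
  divides it too, and \<open>(2 * m + 1) * ?c\<close> is at least \<open>4 ^ m\<close>.\<close>

lemma Lcm_upto_ge_odd:
  assumes "m > 0"
  shows "m * 4 ^ m \<le> Lcm {1..2 * m + 1 :: nat}"
proof -
  let ?D = "Lcm {1..2 * m + 1 :: nat}"
  let ?c = "2 * m choose m"
  have "?D \<noteq> 0" by (simp add: Lcm_0_iff_nat)
  have dvdD: "int k dvd int ?D" if "1 \<le> k" "k \<le> 2 * m + 1" for k
    using that by (simp only: int_dvd_int_iff) (auto intro: dvd_Lcm)
  have "int (m * ?c) dvd int ?D"
    using assms by (intro mult_binomial_dvd dvdD) auto
  then have d1: "m * ?c dvd ?D" by presburger
  have "int (Suc m * ((2 * m + 1) choose Suc m)) dvd int ?D"
    using assms by (intro mult_binomial_dvd dvdD) auto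
  moreover have "Suc m * ((2 * m + 1) choose Suc m) = (2 * m + 1) * ?c"
    using Suc_times_binomial_eq[of "2 * m" m] by (metis Suc_eq_plus1 mult.commute)
  ultimately have d2: "(2 * m + 1) * ?c dvd ?D" by presburger
  have "coprime (2 * m + 1) m"
    by (metis coprime_add_one_left coprime_mult_left_iff coprime_mult_right_iff coprime_commute)
  obtain E where E: "?D = ?c * E" using d1 by (metis dvd_def mult.commute mult.assoc)
  have "?c > 0" by simp
  then have "m dvd E" "2 * m + 1 dvd E"
    using d1 d2 unfolding E by (simp_all only: mult.commute[of _ ?c] nat_mult_dvd_cancel_disj) auto
  then have "m * (2 * m + 1) dvd E"
    using \<open>coprime (2 * m + 1) m\<close> by (simp only: divides_mult coprime_commute)
  then have "(m * (2 * m + 1)) * ?c dvd ?D"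
    unfolding E by (simp only: mult.commute[of _ ?c] mult_dvd_mono dvd_refl)
  then have le: "(m * (2 * m + 1)) * ?c \<le> ?D" using \<open>?D \<noteq> 0\<close> by (intro dvd_imp_le) (simp_all only: neq0_conv)

  have "4 ^ m \<le> (2 * m + 1) * ?c"
  proof -
    have "real (4 ^ m) \<le> real (2 * m * ?c)"
      using central_binomial_lower_bound[OF assms] assms by (simp add: field_simps)
    then have "4 ^ m \<le> 2 * m * ?c" by (simp only: of_nat_le_iff)
    then show ?thesis by (simp add: algebra_simps)
  qed
  then have "m * 4 ^ m \<le> (m * (2 * m + 1)) * ?c"
    unfolding mult.assoc by (rule mult_le_mono2)
  then show ?thesis using le by (rule order_trans)
qed

lemma Lcm_upto_ge:
  assumes "N \<ge> 9"
  shows "2 ^ N \<le> Lcm {1..N :: nat}"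
proof -
  \<comment> \<open>\<open>2 * m + 1\<close> is \<open>N\<close> or \<open>N - 1\<close>. The factor
    \<open>m\<close> in the odd case absorbs the excess 4 of \<open>4 ^ (m + 1)\<close> as soon as
    \<open>m \<ge> 4\<close>, that is, \<open>N \<ge> 9\<close>.\<close>
  define m where "m = (N - 1) div 2"
  have m: "m \<ge> 4" "2 * m + 1 \<le> N" "N \<le> 2 * (m + 1)" using assms by (auto simp: m_def)
  have "(2::nat) ^ N \<le> 2 ^ (2 * (m + 1))" using m by (intro power_increasing) auto
  also have "\<dots> = 4 * 4 ^ m" by (simp add: power_mult)
  also have "\<dots> \<le> m * 4 ^ m" using m by simp
  also have "\<dots> \<le> Lcm {1..2 * m + 1}" using m by (intro Lcm_upto_ge_odd) auto
  also have "\<dots> \<le> Lcm {1..N}"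
    using m by (intro dvd_imp_le Lcm_subset) (auto simp: neq0_conv[symmetric] Lcm_0_iff_nat simp del: neq0_conv)
  finally show ?thesis .
qed

text \<open>The exponent of a prime in the lcm is attained at some \<open>k \<le> N\<close>, so
  every prime power in its factorization is at most \<open>N\<close>, and only primes up to
  \<open>N\<close> occur.\<close>

lemma Lcm_upto_le: "Lcm {1..N :: nat} \<le> N ^ card (primes_upto_set N)"
proof (cases "N = 0")
  case False
  let ?D = "Lcm {1..N}"
  have D0: "?D \<noteq> 0" by (simp add: Lcm_0_iff_nat)
  have bound: "p ^ multiplicity p ?D \<le> N \<and> p \<in> primes_upto_set N" if p: "p \<in> prime_factors ?D" for p
  proof -
    have pr: "Factorial_Ring.prime p" using p by auto
    \<comment> \<open>A supremum of multisets is meaningful only for a bounded set; the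
      factorization of the lcm is an upper bound.\<close>
    have bdd: "subset_mset.bdd_above (prime_factorization ` {1..N})"
      using D0 by (intro subset_mset.bdd_aboveI[of _ "prime_factorization ?D"])
        (auto simp: prime_factorization_subset_iff_dvd intro!: dvd_Lcm)
    have "count (Sup (prime_factorization ` {1..N})) p = Sup ((\<lambda>M. count M p) ` prime_factorization ` {1..N})"
      using False bdd by (subst count_Sup_multiset_nonempty) (auto simp: image_image)
    then have "multiplicity p ?D = Sup ((\<lambda>k. multiplicity p k) ` {1..N})"
      using D0 pr by (simp add: image_image count_prime_factorization_prime flip: prime_factorization_Lcm)
    moreover have "Sup ((\<lambda>k. multiplicity p k) ` {1..N}) \<in> (\<lambda>k. multiplicity p k) ` {1..N}"
      using False by (subst cSup_eq_Max) (auto intro!: Max_in)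
    ultimately obtain k where k: "k \<in> {1..N}" "multiplicity p ?D = multiplicity p k" by auto
    have "p ^ multiplicity p k \<le> k" using k by (intro dvd_imp_le multiplicity_dvd) auto
    moreover have "multiplicity p k > 0"
      using k p by (metis prime_factors_multiplicity mem_Collect_eq)
    then have "p \<le> k" using k by (metis atLeastAtMost_iff dvd_imp_le less_eq_Suc_le not_dvd_imp_multiplicity_0 not_less_zero One_nat_def)
    ultimately show ?thesis using k pr by (auto simp: primes_upto_set_def)
  qed
  have "?D = (\<Prod>p\<in>prime_factors ?D. p ^ multiplicity p ?D)"
    using prod_prime_factors[OF D0] by simp
  also have "\<dots> \<le> (\<Prod>p\<in>prime_factors ?D. N)"
    using bound by (intro prod_mono) auto
  also have "\<dots> = N ^ card (prime_factors ?D)" by simp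
  also have "\<dots> \<le> N ^ card (primes_upto_set N)"
    using bound False by (intro power_increasing card_mono) auto
  finally show ?thesis .
next
  case True
  then have "primes_upto_set N = {}" by (auto simp: primes_upto_set_def)
  with True show ?thesis by simp
qed

text \<open>The second hypothesis says that the binary logarithm of \<open>N\<close> is at most
  \<open>b / a\<close>. In this form the bound \<open>N / log 2 N\<close> for the number of primes
  is used without leaving the natural numbers.\<close>

lemma card_primes_upto_ge:
  assumes "N \<ge> 9" "N ^ a \<le> 2 ^ b"
  shows "a * N \<le> b * card (primes_upto_set N)"
proof -
  have "(2::nat) ^ (a * N) = (2 ^ N) ^ a" by (simp add: power_mult[symmetric] mult.commute)
  also have "\<dots> \<le> (N ^ card (primes_upto_set N)) ^ a"
    using Lcm_upto_ge[OF assms(1)] Lcm_upto_le[of N] by (intro power_mono) auto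
  also have "\<dots> = (N ^ a) ^ card (primes_upto_set N)"
    by (simp add: power_mult[symmetric] mult.commute)
  also have "\<dots> \<le> (2 ^ b) ^ card (primes_upto_set N)" using assms(2) by (intro power_mono) auto
  also have "\<dots> = 2 ^ (b * card (primes_upto_set N))" by (simp add: power_mult)
  finally show ?thesis by simp
qed

subsection \<open>Norms of ideals\<close>

text \<open>Allows a quotient to be counted through any invariant with the same fibres; below,
  cosets are counted through coordinates modulo \<open>p\<close>.\<close>

lemma card_image_eqI:
  assumes "\<And>a b. a \<in> S \<Longrightarrow> b \<in> S \<Longrightarrow> f a = f b \<longleftrightarrow> g a = g b"
  shows "card (f ` S) = card (g ` S)"
proof -
  have *: "inv_into S f (f a) \<in> S \<and> f (inv_into S f (f a)) = f a" if "a \<in> S" for a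
    using that by (auto intro: inv_into_into f_inv_into_f)
  then have g: "g (inv_into S f (f a)) = g a" if "a \<in> S" for a
    using that assms by blast
  have "bij_betw (\<lambda>y. g (inv_into S f y)) (f ` S) (g ` S)"
    unfolding bij_betw_def
  proof
    show "inj_on (\<lambda>y. g (inv_into S f y)) (f ` S)"
      by (rule inj_onI) (auto simp: g assms)
    show "(\<lambda>y. g (inv_into S f y)) ` f ` S = g ` S"
      by (auto simp: g image_image)
  qed
  then show ?thesis by (rule bij_betw_same_card)
qed

lemma carrier_Quot: "carrier (A Quot I) = (\<lambda>a. I +>\<^bsub>A\<^esub> a) ` carrier A"
  by (auto simp: FactRing_def A_RCOSETS_def' a_r_coset_def')

text \<open>The ideal quotient (I : x), which is the kernel of the map from \<open>A\<close> to
  \<open>A / I\<close> that sends \<open>a\<close> to the class of \<open>a x\<close>. Hence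
  \<open>A / (I : x)\<close> is isomorphic to \<open>(I + xA) / I\<close>.\<close>

definition colon_ideal :: "('a, 'b) ring_scheme \<Rightarrow> 'a set \<Rightarrow> 'a \<Rightarrow> 'a set" where
  "colon_ideal A I x = {a \<in> carrier A. a \<otimes>\<^bsub>A\<^esub> x \<in> I}"

lemma ideal_colon_ideal:
  assumes "cring A" "ideal I A" "x \<in> carrier A"
  shows "ideal (colon_ideal A I x) A"
proof -
  interpret cring A by fact
  interpret ideal I A by fact
  show ?thesis
  proof (rule idealI)
    show "subgroup (colon_ideal A I x) (add_monoid A)"
    proof
      show "inv\<^bsub>add_monoid A\<^esub> a \<in> colon_ideal A I x" if "a \<in> colon_ideal A I x" for a
        using that assms(3) l_minus[of a x] by (auto simp: colon_ideal_def a_inv_def[symmetric] simp del: l_minus)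
    qed (use assms(3) in \<open>auto simp: colon_ideal_def l_distr\<close>)
    fix a b assume "a \<in> colon_ideal A I x" "b \<in> carrier A"
    then show "b \<otimes>\<^bsub>A\<^esub> a \<in> colon_ideal A I x" "a \<otimes>\<^bsub>A\<^esub> b \<in> colon_ideal A I x"
      using assms(3) I_l_closed[of "a \<otimes>\<^bsub>A\<^esub> x" b]
      by (auto simp: colon_ideal_def m_assoc m_comm[of a b])
  qed (rule ring_axioms)
qed

text \<open>Counts the exact sequence from \<open>A / (I : x)\<close> through \<open>A / I\<close>
  to \<open>A / (I + xA)\<close>. With chosen representatives \<open>r C\<close> and
  \<open>s D\<close>, every class modulo \<open>I\<close> is that of \<open>r C + (s D) x\<close>
  for exactly one pair \<open>(C, D)\<close>.\<close>

lemma card_Quot_mult: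
  fixes A (structure)
  assumes "cring A" "ideal I A" "x \<in> carrier A"
  shows "card (carrier (A Quot I)) =
    card (carrier (A Quot (I <+>\<^bsub>A\<^esub> PIdl x))) * card (carrier (A Quot (colon_ideal A I x)))"
proof -
  interpret cring A by fact
  interpret I: ideal I A by fact
  define J where "J = I <+>\<^bsub>A\<^esub> PIdl x"
  define K where "K = colon_ideal A I x"
  have J: "ideal J A" unfolding J_def by (intro add_ideals assms cgenideal_ideal)
  have K: "ideal K A" unfolding K_def by (intro ideal_colon_ideal assms)
  have memJ: "y \<in> J \<longleftrightarrow> (\<exists>i\<in>I. \<exists>b\<in>carrier A. y = i \<oplus> b \<otimes> x)" for y
    by (auto simp: J_def set_add_def' cgenideal_def)
  define r where "r = inv_into (carrier A) (\<lambda>a. J +> a)"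
  define s where "s = inv_into (carrier A) (\<lambda>a. K +> a)"
  have r: "r C \<in> carrier A" "J +> r C = C" if "C \<in> carrier (A Quot J)" for C
    using that f_inv_into_f[of C "\<lambda>a. J +> a"] unfolding r_def carrier_Quot
    by (auto intro: inv_into_into)
  have s: "s C \<in> carrier A" "K +> s C = C" if "C \<in> carrier (A Quot K)" for C
    using that f_inv_into_f[of C "\<lambda>a. K +> a"] unfolding s_def carrier_Quot
    by (auto intro: inv_into_into)
  let ?f = "\<lambda>(C, D). I +> (r C \<oplus> s D \<otimes> x)"
  note eqI = quotient_eq_iff_same_a_r_cos[OF assms(2), symmetric]
  note eqJ = quotient_eq_iff_same_a_r_cos[OF J, symmetric]
  note eqK = quotient_eq_iff_same_a_r_cos[OF K, symmetric]
  have "bij_betw ?f (carrier (A Quot J) \<times> carrier (A Quot K)) (carrier (A Quot I))"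
    unfolding bij_betw_def
  proof
    show "inj_on ?f (carrier (A Quot J) \<times> carrier (A Quot K))"
    proof (rule inj_onI, clarify)
      fix C D C' D'
      assume mem: "C \<in> carrier (A Quot J)" "D \<in> carrier (A Quot K)"
        "C' \<in> carrier (A Quot J)" "D' \<in> carrier (A Quot K)"
      note rs = r[OF mem(1)] r[OF mem(3)] s[OF mem(2)] s[OF mem(4)]
      assume "I +> (r C \<oplus> s D \<otimes> x) = I +> (r C' \<oplus> s D' \<otimes> x)"
      then have i: "(r C \<oplus> s D \<otimes> x) \<ominus> (r C' \<oplus> s D' \<otimes> x) \<in> I"
        using rs assms(3) by (simp add: eqI)
      \<comment> \<open>The representatives differ by an element of \<open>I + xA\<close>, hence
        coincide; cancelling them leaves \<open>(s D - s D') x\<close> in \<open>I\<close>.\<close>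
      have "r C \<ominus> r C' = ((r C \<oplus> s D \<otimes> x) \<ominus> (r C' \<oplus> s D' \<otimes> x)) \<oplus> (s D' \<ominus> s D) \<otimes> x"
        using rs assms(3) by algebra
      then have "r C \<ominus> r C' \<in> J" using i rs unfolding memJ by (meson minus_closed)
      then have C: "C = C'" using eqJ rs by metis
      have "(s D \<ominus> s D') \<otimes> x = (r C \<oplus> s D \<otimes> x) \<ominus> (r C \<oplus> s D' \<otimes> x)"
        using rs assms(3) by algebra
      then have "s D \<ominus> s D' \<in> K" using i rs C by (simp add: K_def colon_ideal_def)
      then show "C = C' \<and> D = D'" using eqK rs C by metis
    qed
    show "?f ` (carrier (A Quot J) \<times> carrier (A Quot K)) = carrier (A Quot I)"
    proof (intro equalityI subsetI)
      fix y assume "y \<in> ?f ` (carrier (A Quot J) \<times> carrier (A Quot K))"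
      then show "y \<in> carrier (A Quot I)"
        using r(1) s(1) assms(3) by (auto simp: carrier_Quot[of A I])
    next
      fix y assume "y \<in> carrier (A Quot I)"
      then obtain a where a: "a \<in> carrier A" "y = I +> a" by (auto simp: carrier_Quot)
      define C where "C = J +> a"
      have C: "C \<in> carrier (A Quot J)" using a by (auto simp: C_def carrier_Quot)
      have "a \<ominus> r C \<in> J" using eqJ[of a "r C"] r[OF C] a C_def by simp
      then obtain i b where ib: "i \<in> I" "b \<in> carrier A" "a \<ominus> r C = i \<oplus> b \<otimes> x"
        unfolding memJ by blast
      define D where "D = K +> b"
      have D: "D \<in> carrier (A Quot K)" using ib by (auto simp: D_def carrier_Quot)
      have "b \<ominus> s D \<in> K" using eqK[of b "s D"] s[OF D] ib D_def by simp
      then have k: "(b \<ominus> s D) \<otimes> x \<in> I" by (simp add: K_def colon_ideal_def)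
      have i: "i \<in> carrier A" using ib by simp
      \<comment> \<open>Replacing \<open>b\<close> by the representative \<open>s D\<close> of its
        class changes \<open>b x\<close> only by an element of \<open>I\<close>.\<close>
      have "a \<ominus> (r C \<oplus> s D \<otimes> x) = (a \<ominus> r C) \<ominus> s D \<otimes> x"
        using a r[OF C] s[OF D] assms(3) by algebra
      also have "\<dots> = i \<oplus> (b \<ominus> s D) \<otimes> x"
        unfolding ib(3) using i ib s[OF D] assms(3) by algebra
      also have "\<dots> \<in> I" using ib k by simp
      finally have "y = ?f (C, D)"
        using a r[OF C] s[OF D] assms(3) eqI[of a] by simp
      with C D show "y \<in> ?f ` (carrier (A Quot J) \<times> carrier (A Quot K))" by blast
    qed
  qed
  from bij_betw_same_card[OF this] show ?thesis
    by (simp add: card_cartesian_product J_def K_def)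
qed

text \<open>
  If the proper ideal \<open>I\<close> is not maximal, choose \<open>x\<close> such that \<open>I + xA\<close> lies strictly between \<open>I\<close> and \<open>A\<close>:
  then both factors in the previous lemma are smaller than \<open>card (A / I)\<close>.
\<close>

lemma card_Quot_cong_one:
  fixes A (structure)
  assumes "cring A" "ideal I A" "finite (carrier (A Quot I))"
    and "\<And>M. maximalideal M A \<Longrightarrow> I \<subseteq> M \<Longrightarrow> [card (carrier (A Quot M)) = 1] (mod l)"
  shows "[card (carrier (A Quot I)) = 1] (mod l)"
  using assms(2-)
proof (induction "card (carrier (A Quot I))" arbitrary: I rule: less_induct)
  case less
  interpret cring A by fact
  interpret I: ideal I A by fact
  show ?case
  proof (cases "maximalideal I A")
    case True
    then show ?thesis using less.prems by blast
  next
    case nonmax: False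
    show ?thesis
    proof (cases "I = carrier A")
      case True
      have "carrier (A Quot I) = {carrier A}"
        unfolding carrier_Quot True using a_coset_join2[of _ "carrier A"] additive_subgroup.a_subgroup[OF I.additive_subgroup_axioms] True
        by auto
      then show ?thesis by simp
    next
      case False
      then obtain J0 where J0: "ideal J0 A" "I \<subseteq> J0" "J0 \<noteq> I" "J0 \<noteq> carrier A"
        using nonmax maximalidealI[OF less.prems(1)] by (metis ideal.Icarr subsetI)
      then obtain x where x: "x \<in> J0" "x \<notin> I" by blast
      have xc: "x \<in> carrier A" using x J0 by (meson ideal.Icarr)
      define J where "J = I <+>\<^bsub>A\<^esub> PIdl x"
      define K where "K = colon_ideal A I x"
      have J: "ideal J A" unfolding J_def by (intro add_ideals less.prems cgenideal_ideal xc)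
      have K: "ideal K A" unfolding K_def by (intro ideal_colon_ideal assms(1) less.prems xc)
      have IJ: "I \<subseteq> J"
      proof
        fix i assume "i \<in> I"
        moreover have "i = i \<oplus> \<zero> \<otimes> x" using xc \<open>i \<in> I\<close> by simp
        ultimately show "i \<in> J" unfolding J_def set_add_def' cgenideal_def by blast
      qed
      have IK: "I \<subseteq> K" using I.I_r_closed xc by (auto simp: K_def colon_ideal_def)
      have JJ0: "J \<subseteq> J0"
        using J0 x xc ideal.I_l_closed[OF J0(1)] additive_subgroup.a_closed[OF ideal.axioms(1)[OF J0(1)]]
        unfolding J_def set_add_def' cgenideal_def by blast
      have card_gt: "card (carrier (A Quot L)) \<noteq> 1" if L: "ideal L A" "L \<noteq> carrier A" for L
      proof
        assume "card (carrier (A Quot L)) = 1"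
        then obtain c where c: "carrier (A Quot L) = {c}" by (auto simp: card_1_singleton_iff)
        have "a \<in> L" if "a \<in> carrier A" for a
        proof -
          have "L +> a = L +> \<zero>"
            using c that unfolding carrier_Quot by (metis imageI singletonD zero_closed)
          then have "a \<ominus> \<zero> \<in> L" using quotient_eq_iff_same_a_r_cos[OF L(1)] that by simp
          then show ?thesis using that by (simp add: a_minus_def)
        qed
        with L show False using ideal.Icarr[OF L(1)] by blast
      qed
      have mult: "card (carrier (A Quot I)) = card (carrier (A Quot J)) * card (carrier (A Quot K))"
        unfolding J_def K_def by (intro card_Quot_mult assms(1) less.prems xc)
      have "carrier (A Quot I) \<noteq> {}" by (auto simp: carrier_Quot)
      then have "card (carrier (A Quot I)) > 0" using less.prems(2) by (simp add: card_gt_0_iff)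
      then have pos: "card (carrier (A Quot J)) > 0" "card (carrier (A Quot K)) > 0"
        unfolding mult by simp_all
      have "J \<noteq> carrier A" using JJ0 J0 ideal.Icarr[OF J0(1)] by blast
      then have "card (carrier (A Quot J)) > 1" using card_gt[OF J] pos by linarith
      moreover have "\<one> \<notin> K" using x xc by (simp add: K_def colon_ideal_def)
      then have "card (carrier (A Quot K)) > 1" using card_gt[OF K] pos by force
      \<comment> \<open>The roles cross: each factor is smaller than the product because the other
        one exceeds 1.\<close>
      ultimately have lt: "card (carrier (A Quot J)) < card (carrier (A Quot I))"
        "card (carrier (A Quot K)) < card (carrier (A Quot I))"
        unfolding mult using pos by simp_all
      have fin: "finite (carrier (A Quot J))" "finite (carrier (A Quot K))"
        using pos by (simp_all add: card_gt_0_iff)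
      have "[card (carrier (A Quot J)) = 1] (mod l)" "[card (carrier (A Quot K)) = 1] (mod l)"
        using less.hyps[OF lt(1) J fin(1)] less.hyps[OF lt(2) K fin(2)] less.prems(3) IJ IK by blast+
      then have "[card (carrier (A Quot J)) * card (carrier (A Quot K)) = 1 * 1] (mod l)"
        by (rule cong_mult)
      then show ?thesis unfolding mult by simp
    qed
  qed
qed

text \<open>Multiplication by \<open>?q\<close> is \<open>p\<close>-fold addition, so under
  \<open>h\<close> the ideal \<open>pA\<close> becomes the sublattice of vectors divisible by
  \<open>p\<close>. Its cosets correspond to the vectors of residues modulo
  \<open>p\<close>.\<close>

lemma card_Quot_PIdl_nat:
  fixes A (structure)
  assumes "order_of_rank A n" "p > 0"
  shows "card (carrier (A Quot PIdl (add_pow A p \<one>))) = p ^ n"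
proof -
  interpret cring A using assms(1) by (simp add: order_of_rank_def)
  let ?q = "add_pow A p \<one>"
  obtain h where h: "h \<in> iso (add_monoid A) (product_group {..<n} (\<lambda>_. integer_group))"
    using assms(1) by (auto simp: order_of_rank_def is_iso_def)
  have hbij: "bij_betw h (carrier A) ({..<n} \<rightarrow>\<^sub>E UNIV)"
    using h by (simp add: iso_def)
  have hadd: "h (a \<oplus> b) i = h a i + h b i" if "a \<in> carrier A" "b \<in> carrier A" "i < n" for a b i
    using h that by (auto simp: iso_def hom_def)
  have hpow: "h (add_pow A k a) i = int k * h a i" if "a \<in> carrier A" "i < n" for k a i
  proof (induction k)
    case 0
    have "h \<zero> i = h \<zero> i + h \<zero> i" using hadd[of \<zero> \<zero> i] that by simp
    then show ?case by simp
  next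
    case (Suc k)
    then show ?case using that by (simp add: hadd algebra_simps add.nat_pow_Suc)
  qed
  have hminus: "h (a \<ominus> b) i = h a i - h b i" if "a \<in> carrier A" "b \<in> carrier A" "i < n" for a b i
  proof -
    have "h ((a \<ominus> b) \<oplus> b) i = h (a \<ominus> b) i + h b i" using that by (simp add: hadd)
    moreover have "(a \<ominus> b) \<oplus> b = a" using that by algebra
    ultimately show ?thesis by simp
  qed
  have mem: "c \<in> PIdl ?q \<longleftrightarrow> (\<forall>i<n. int p dvd h c i)" if c: "c \<in> carrier A" for c
  proof
    assume "c \<in> PIdl ?q"
    then obtain a where a: "a \<in> carrier A" "c = a \<otimes> ?q" by (auto simp: cgenideal_def)
    then have "c = add_pow A p a" using add_pow_rdistr[of a \<one> p] by simp
    then show "\<forall>i<n. int p dvd h c i" using a hpow by simp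
  next
    assume d: "\<forall>i<n. int p dvd h c i"
    \<comment> \<open>Coordinatewise division by \<open>p\<close> gives the cofactor. The
      restriction keeps the vector in the extensional product, where values outside
      \<open>{..<n}\<close> are \<open>undefined\<close>.\<close>
    have "(\<lambda>i\<in>{..<n}. h c i div int p) \<in> h ` carrier A"
      using bij_betw_imp_surj_on[OF hbij] by auto
    then obtain a where a: "a \<in> carrier A" "h a = (\<lambda>i\<in>{..<n}. h c i div int p)" by (metis imageE)
    have "h (add_pow A p a) = h c"
    proof (rule PiE_ext)
      show "h (add_pow A p a) \<in> {..<n} \<rightarrow>\<^sub>E UNIV" "h c \<in> {..<n} \<rightarrow>\<^sub>E UNIV"
        using bij_betwE[OF hbij] a c by auto
    qed (use hpow[OF a(1)] a d in auto)
    then have "c = add_pow A p a"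
      using bij_betw_imp_inj_on[OF hbij] a c by (auto dest: inj_onD)
    then have "c = a \<otimes> ?q" using add_pow_rdistr[of a \<one> p] a by simp
    then show "c \<in> PIdl ?q" using a by (auto simp: cgenideal_def)
  qed
  let ?g = "\<lambda>a. \<lambda>i\<in>{..<n}. h a i mod int p"
  have "card (carrier (A Quot PIdl ?q)) = card (?g ` carrier A)"
    unfolding carrier_Quot
  proof (rule card_image_eqI)
    fix a b assume ab: "a \<in> carrier A" "b \<in> carrier A"
    have "PIdl ?q +> a = PIdl ?q +> b \<longleftrightarrow> (\<forall>i<n. int p dvd h a i - h b i)"
      using quotient_eq_iff_same_a_r_cos[OF cgenideal_ideal, of ?q a b] ab mem[of "a \<ominus> b"] hminus by simp
    also have "\<dots> \<longleftrightarrow> ?g a = ?g b"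
      by (auto simp: fun_eq_iff mod_eq_dvd_iff restrict_def)
    finally show "PIdl ?q +> a = PIdl ?q +> b \<longleftrightarrow> ?g a = ?g b" .
  qed
  also have "?g ` carrier A = {..<n} \<rightarrow>\<^sub>E {0..<int p}"
  proof (intro equalityI subsetI)
    fix y assume y: "y \<in> {..<n} \<rightarrow>\<^sub>E {0..<int p}"
    then have "y \<in> h ` carrier A"
      using bij_betw_imp_surj_on[OF hbij] by (auto simp: PiE_iff)
    then obtain a where a: "a \<in> carrier A" "y = h a" by blast
    have "?g a = y"
    proof (rule PiE_ext)
      show "?g a \<in> {..<n} \<rightarrow>\<^sub>E UNIV" "y \<in> {..<n} \<rightarrow>\<^sub>E UNIV" using y by (auto simp: PiE_iff)
    qed (use y a in \<open>auto simp: PiE_iff\<close>)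
    from this[symmetric] a(1) show "y \<in> ?g ` carrier A" by (rule image_eqI)
  qed (use assms(2) in auto)
  also have "card ({..<n} \<rightarrow>\<^sub>E {0..<int p}) = p ^ n"
    by (simp add: card_PiE)
  finally show ?thesis .
qed

lemma prime_power_rank_cong_one:
  fixes A (structure)
  assumes "order_of_rank A n" "p > 0"
    and max: "\<And>M. maximalideal M A \<Longrightarrow> add_pow A p \<one> \<in> M \<Longrightarrow> [card (carrier (A Quot M)) = 1] (mod l)"
  shows "[p ^ n = 1] (mod l)"
proof -
  interpret cring A using assms(1) by (simp add: order_of_rank_def)
  let ?q = "add_pow A p \<one>"
  note card = card_Quot_PIdl_nat[OF assms(1,2)]
  have "[card (carrier (A Quot PIdl ?q)) = 1] (mod l)"
  proof (rule card_Quot_cong_one)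
    show "finite (carrier (A Quot PIdl ?q))"
      using card assms(2) by (intro card_ge_0_finite) simp
    show "[card (carrier (A Quot M)) = 1] (mod l)" if "maximalideal M A" "PIdl ?q \<subseteq> M" for M
      using that max cgenideal_self[of ?q] by auto
  qed (simp_all add: cgenideal_ideal is_cring)
  then show ?thesis by (simp add: card)
qed

subsection \<open>Quotients of products of small primes\<close>

text \<open>For a set of primes, a pair \<open>(U, V)\<close> encodes the reduced fraction with
  numerator \<open>\<Prod>U\<close> and denominator \<open>\<Prod>V\<close>; disjointness is
  coprimality.\<close>

definition disjoint_subset_pairs :: "'a set \<Rightarrow> nat \<Rightarrow> ('a set \<times> 'a set) set" where
  "disjoint_subset_pairs S j =
    Sigma {U. U \<subseteq> S \<and> card U = j} (\<lambda>U. {V. V \<subseteq> S - U \<and> card V = j})"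

lemma card_disjoint_subset_pairs:
  assumes "finite S"
  shows "card (disjoint_subset_pairs S j) = (card S choose j) * ((card S - j) choose j)"
proof -
  have "card {V. V \<subseteq> S - U \<and> card V = j} = (card S - j) choose j" if "U \<subseteq> S" "card U = j" for U
    using assms that by (simp add: n_subsets card_Diff_subset finite_subset)
  then show ?thesis
    using assms by (simp add: disjoint_subset_pairs_def card_SigmaI n_subsets)
qed

lemma prime_factors_prod_primes:
  fixes U :: "nat set"
  assumes "finite U" "\<And>p. p \<in> U \<Longrightarrow> Factorial_Ring.prime p"
  shows "prime_factors (\<Prod>U) = U"
proof -
  have "0 \<notin> U" using assms(2) by (metis not_prime_0)
  then have "prime_factors (\<Prod>U) = (\<Union>p\<in>U. prime_factors p)"
    using assms(1) prime_factors_prod[of U "\<lambda>p. p"] by simp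
  also have "\<dots> = U" using assms(2) by (auto simp: prime_prime_factors)
  finally show ?thesis .
qed

text \<open>The map \<open>f\<close> sends the fractions injectively to roots of
  \<open>x ^ n = 1\<close> modulo the prime \<open>l\<close>, and there are at most \<open>n\<close>
  of those. The left side counts the fractions.\<close>

lemma binomial_le_roots_of_unity:
  fixes n l N j :: nat
  assumes l: "Factorial_Ring.prime l" "n ^ 2 < l" and n: "n > 0"
    and N: "N ^ j \<le> n"
    and roots: "\<And>p. Factorial_Ring.prime p \<Longrightarrow> p \<le> N \<Longrightarrow> [p ^ n = 1] (mod l)"
  defines "P \<equiv> card (primes_upto_set N)"
  shows "(P choose j) * ((P - j) choose j) \<le> n"
proof -
  define T where "T = disjoint_subset_pairs (primes_upto_set N) j"
  \<comment> \<open>Since \<open>\<Prod>V ^ n\<close> is 1 modulo \<open>l\<close>, the power with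
    exponent \<open>n - 1\<close> is the inverse of \<open>\<Prod>V\<close>.\<close>
  define f where "f = (\<lambda>(U, V). (\<Prod>U * \<Prod>V ^ (n - 1)) mod l)"
  have X: "finite U" "\<Prod>U \<le> n" "\<Prod>U > 0" "[\<Prod>U ^ n = 1] (mod l)" "prime_factors (\<Prod>U) = U"
    if "U \<subseteq> primes_upto_set N" "card U = j" for U
  proof -
    show fin: "finite U" using that by (metis finite_primes_upto_set finite_subset)
    have pr: "Factorial_Ring.prime p" "p \<le> N" if "p \<in> U" for p
      using \<open>U \<subseteq> _\<close> that by (auto simp: primes_upto_set_def)
    have "\<Prod>U \<le> (\<Prod>p\<in>U. N)" using pr by (intro prod_mono) auto
    then show "\<Prod>U \<le> n" using N that by simp
    show "\<Prod>U > 0" using pr by (intro prod_pos) (auto simp: prime_gt_0_nat)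
    have "[(\<Prod>p\<in>U. p ^ n) = (\<Prod>p\<in>U. 1)] (mod l)"
      using pr roots by (intro cong_prod) auto
    then show "[\<Prod>U ^ n = 1] (mod l)" by (simp add: prod_power_distrib)
    show "prime_factors (\<Prod>U) = U" using fin pr by (intro prime_factors_prod_primes) auto
  qed
  have "inj_on f T"
  proof (rule inj_onI)
    fix t t' assume tt: "t \<in> T" "t' \<in> T" "f t = f t'"
    obtain U V U' V' where t: "t = (U, V)" "t' = (U', V')" by (metis surj_pair)
    note UV = tt(1,2)[unfolded t T_def disjoint_subset_pairs_def mem_Sigma_iff mem_Collect_eq]
    have sub: "U \<subseteq> primes_upto_set N" "V \<subseteq> primes_upto_set N" "U' \<subseteq> primes_upto_set N"
      "V' \<subseteq> primes_upto_set N"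
      and card: "card U = j" "card V = j" "card U' = j" "card V' = j"
      and disj: "U \<inter> V = {}" "U' \<inter> V' = {}"
      using UV by blast+
    note X = X[OF sub(1) card(1)] X[OF sub(2) card(2)] X[OF sub(3) card(3)] X[OF sub(4) card(4)]
    define a b a' b' where "a = \<Prod>U" "b = \<Prod>V" "a' = \<Prod>U'" "b' = \<Prod>V'"
    note ab = this
    have le: "a \<le> n" "b \<le> n" "a' \<le> n" "b' \<le> n"
      and pos: "a > 0" "b > 0" "a' > 0" "b' > 0"
      and root: "[b ^ n = 1] (mod l)" "[b' ^ n = 1] (mod l)"
      and pf: "prime_factors a = U" "prime_factors b = V" "prime_factors a' = U'" "prime_factors b' = V'"
      using X unfolding ab by simp_all
    have pow: "c ^ n = c ^ (n - 1) * c" for c :: nat using n by (metis power_minus_mult)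
    have "[a * b ^ (n - 1) = a' * b' ^ (n - 1)] (mod l)"
      using tt(3) unfolding t f_def ab by (simp add: cong_def)
    \<comment> \<open>Multiplication by \<open>b * b'\<close> clears both denominators. The
      resulting products are at most \<open>n ^ 2\<close>, which turns the congruence into an
      equality.\<close>
    then have "[a * b ^ (n - 1) * (b * b') = a' * b' ^ (n - 1) * (b * b')] (mod l)"
      by (rule cong_mult) (rule cong_refl)
    then have "[(a * b') * b ^ n = (a' * b) * b' ^ n] (mod l)"
      unfolding pow by (simp add: mult_ac)
    moreover have "[(a * b') * b ^ n = (a * b') * 1] (mod l)" "[(a' * b) * b' ^ n = (a' * b) * 1] (mod l)"
      using root by (intro cong_mult cong_refl; simp)+
    ultimately have "[a * b' = a' * b] (mod l)"
      unfolding mult_1_right by (metis cong_sym cong_trans)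
    moreover have "a * b' < l" "a' * b < l"
      using l(2) mult_le_mono[OF le(1,4)] mult_le_mono[OF le(3,2)] by (simp_all add: power2_eq_square)
    ultimately have eq: "a * b' = a' * b" by (metis cong_less_modulus_unique_nat)
    \<comment> \<open>Comparing prime factors and using disjointness gives one inclusion for
      numerators and one for denominators; equal cardinalities turn both into equalities.\<close>
    have "U \<union> V' = U' \<union> V"
      using arg_cong[OF eq, of prime_factors] pos pf by (simp add: prime_factors_product)
    then have "U \<subseteq> U'" "V' \<subseteq> V" using disj by blast+
    then show "t = t'" using card t X(1,6,11) card_subset_eq by metis
  qed
  moreover have "f ` T \<subseteq> {x \<in> {..<l}. [x ^ n = 1] (mod l)}"
  proof (rule image_subsetI)
    fix t assume "t \<in> T"
    then obtain U V where t: "t = (U, V)" and sub: "U \<subseteq> primes_upto_set N" "card U = j"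
      "V \<subseteq> primes_upto_set N" "card V = j"
      unfolding T_def disjoint_subset_pairs_def by blast
    define a b where "a = \<Prod>U" "b = \<Prod>V"
    have roots: "[a ^ n = 1] (mod l)" "[b ^ n = 1] (mod l)"
      using X(4)[OF sub(1,2)] X(4)[OF sub(3,4)] unfolding a_b_def .
    have "[a ^ n * (b ^ n) ^ (n - 1) = 1 * 1 ^ (n - 1)] (mod l)"
      by (rule cong_mult[OF roots(1) cong_pow[OF roots(2)]])
    moreover have "(a * b ^ (n - 1)) ^ n = a ^ n * (b ^ n) ^ (n - 1)"
      by (simp add: power_mult_distrib power_mult[symmetric] mult.commute)
    ultimately have "[(a * b ^ (n - 1)) ^ n = 1] (mod l)" by simp
    then show "f t \<in> {x \<in> {..<l}. [x ^ n = 1] (mod l)}"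
      using l(2) by (simp add: f_def t cong_def power_mod flip: a_b_def)
  qed
  ultimately have "card T \<le> card {x \<in> {..<l}. [x ^ n = 1] (mod l)}"
    by (intro card_inj_on_le) auto
  also have "\<dots> \<le> n" using l(1) n by (intro roots_mod_prime_bound)
  finally show ?thesis
    unfolding T_def P_def card_disjoint_subset_pairs[OF finite_primes_upto_set] .
qed

section \<open>Arithmetic consequences of a counterexample\<close>

text \<open>What a counterexample of rank \<open>n\<close> leaves behind once the ring is forgotten.
  The rest of the argument shows that no \<open>n\<close> and \<open>l\<close> satisfy it.\<close>

definition small_primes_unity :: "nat \<Rightarrow> nat \<Rightarrow> bool" where
  "small_primes_unity n l \<longleftrightarrow> n > 0 \<and> Factorial_Ring.prime l \<and> n ^ 2 < l \<and>
    (\<forall>p. Factorial_Ring.prime p \<longrightarrow> real p \<le> 4 * (1 + (ln (real n)) ^ 2) \<longrightarrow> [p ^ n = 1] (mod l))"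

text \<open>\<open>exp (69 / 100)\<close> is the hundredth power of \<open>exp (69 / 10000)\<close>,
  where the quadratic bound is sharp enough. Two tenth powers with rounding in between keep the
  fractions small.\<close>

lemma ln_2_ge_69_hundredths: "69 / 100 \<le> ln (2 :: real)"
proof -
  have exp10: "exp (10 * x) = exp x ^ 10" for x :: real
    using exp_of_nat_mult[of 10 x] by simp
  have "exp (69 / 10000 :: real) \<le> 1 + 69 / 10000 + (69 / 10000)\<^sup>2"
    by (rule exp_bound) simp_all
  also have "\<dots> \<le> 20139 / 20000" by (simp add: power2_eq_square)
  finally have "exp (69 / 10000 :: real) ^ 10 \<le> (20139 / 20000) ^ 10"
    by (rule power_mono) simp
  also have "\<dots> \<le> 107173 / 100000" by (simp add: power_divide)
  finally have "exp (69 / 1000 :: real) \<le> 107173 / 100000"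
    using exp10[of "69 / 10000"] by simp
  then have "exp (69 / 1000 :: real) ^ 10 \<le> (107173 / 100000) ^ 10"
    by (rule power_mono) simp
  also have "\<dots> \<le> 2" by (simp add: power_divide)
  finally have "exp (69 / 100 :: real) \<le> 2"
    using exp10[of "69 / 1000"] by simp
  then show ?thesis by (subst ln_ge_iff) simp_all
qed

text \<open>The constant 19/10 lies just below 4 times the square of 69/100, which is
  1.9044.\<close>

lemma le_ln_squared:
  assumes "2 ^ lam \<le> n" "10 * N \<le> 40 + 19 * lam\<^sup>2"
  shows "real N \<le> 4 * (1 + (ln (real n)) ^ 2)"
proof -
  have "real lam * (69 / 100) \<le> real lam * ln 2"
    by (intro mult_left_mono ln_2_ge_69_hundredths) simp
  also have "\<dots> = ln (real (2 ^ lam))" by (simp add: ln_realpow)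
  also have "\<dots> \<le> ln (real n)"
    using assms(1) by (intro ln_mono) (simp_all only: of_nat_le_iff of_nat_0_less_iff zero_less_power zero_less_numeral)
  finally have "(real lam * (69 / 100))\<^sup>2 \<le> (ln (real n))\<^sup>2"
    by (intro power_mono) simp_all
  then have "(real lam)\<^sup>2 * 4761 \<le> (ln (real n))\<^sup>2 * 10000"
    by (simp add: power_mult_distrib power_divide)
  moreover have "10 * real N \<le> 40 + 19 * (real lam)\<^sup>2"
    using of_nat_mono[OF assms(2), where 'a = real] by simp
  ultimately show ?thesis using zero_le_power2[of "real lam"] by argo
qed

text \<open>Binomials become falling factorials, which are evaluated without division. For
  \<open>m < j\<close> both sides vanish, as one truncated factor is 0.\<close>

lemma fact_mult_binomial: "fact j * (m choose j) = (\<Prod>i<j. m - i)"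
proof (induction j)
  case (Suc j)
  have "fact (Suc j) * (m choose Suc j) = fact j * (Suc j * (m choose Suc j))"
    by (simp only: fact_Suc mult_ac of_nat_id)
  also have "Suc j * (m choose Suc j) = (m - j) * (m choose j)"
    using binomial_absorption[of j m] binomial_absorb_comp[of m j] by simp
  finally show ?case using Suc.IH by (simp add: mult_ac)
qed simp

text \<open>One round of a bootstrap: a known lower bound \<open>m\<close> for \<open>n\<close>
  makes \<open>N\<close> and \<open>j\<close> admissible, and counting fractions yields the new
  lower bound \<open>c\<close>. The condition on \<open>c\<close> is the binomial estimate
  multiplied by \<open>(fact j)\<^sup>2\<close>.\<close>

lemma small_primes_unity_step:
  assumes "small_primes_unity n l" "m \<le> n" "2 ^ lam \<le> m" "N ^ j \<le> m" "10 * N \<le> 40 + 19 * lam\<^sup>2"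
    and P: "P \<le> card (primes_upto_set N)"
    and c: "c * (fact j)\<^sup>2 \<le> (\<Prod>i<j. P - i) * (\<Prod>i<j. P - j - i)"
  shows "c \<le> n"
proof -
  let ?Q = "card (primes_upto_set N)"
  have "real N \<le> 4 * (1 + (ln (real n)) ^ 2)"
    using assms by (intro le_ln_squared[of lam]) auto
  then have roots: "[p ^ n = 1] (mod l)" if "Factorial_Ring.prime p" "p \<le> N" for p
    using assms(1) that unfolding small_primes_unity_def by (meson of_nat_mono order_trans)
  have "c * (fact j)\<^sup>2 \<le> ((P choose j) * (P - j choose j)) * (fact j)\<^sup>2"
    using c unfolding fact_mult_binomial[symmetric] by (simp only: power2_eq_square mult_ac)
  then have "c \<le> (P choose j) * (P - j choose j)" by simp
  also have "\<dots> \<le> (?Q choose j) * (?Q - j choose j)"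
    using P by (intro mult_le_mono binomial_right_mono diff_le_mono)
  also have "\<dots> \<le> n"
    using assms roots unfolding small_primes_unity_def by (intro binomial_le_roots_of_unity[of l]) auto
  finally show ?thesis .
qed

section \<open>Explicit prime counts and the bootstrap from 7 to \<open>2 ^ 188\<close>\<close>

lemma card_primes_upto_ge_length:
  assumes "sorted_wrt (<) ps" "list_all (\<lambda>p. Factorial_Ring.prime p \<and> p \<le> N) ps"
  shows "length ps \<le> card (primes_upto_set N)"
proof -
  have "card (set ps) \<le> card (primes_upto_set N)"
    using assms(2) by (intro card_mono) (auto simp: primes_upto_set_def list_all_iff)
  then show ?thesis
    using assms(1) by (simp add: distinct_card strict_sorted_iff)
qed

definition primes_below_200 :: "nat list" where
  "primes_below_200 = [2, 3, 5, 7, 11, 13, 17, 19, 23, 29, 31, 37, 41, 43, 47, 53, 59, 61, 67, 71, 73, 79,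
     83, 89, 97, 101, 103, 107, 109, 113, 127, 131, 137, 139, 149, 151, 157, 163, 167,
     173, 179, 181, 191, 193, 197, 199]"

text \<open>Trial division: of two proper factors of \<open>p < m * m\<close>, one is below
  \<open>m\<close>. Allowing \<open>q = p\<close> lets the same \<open>m\<close> serve for primes
  below \<open>m\<close>.\<close>

lemma prime_natI_small_divisors:
  fixes p :: nat
  assumes "1 < p" "p < m * m" "\<And>q. 2 \<le> q \<Longrightarrow> q < m \<Longrightarrow> q dvd p \<Longrightarrow> q = p"
  shows "Factorial_Ring.prime p"
proof (rule ccontr)
  assume "\<not> Factorial_Ring.prime p"
  then obtain a where a: "a dvd p" "a \<noteq> 1" "a \<noteq> p"
    using assms(1) unfolding prime_nat_iff by blast
  then obtain b where "p = a * b" by (auto elim: dvdE)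
  with a assms(1) have ab: "p = a * b" "1 < a" "a < p" "1 < b" "b < p"
    by (auto simp: nat_neq_iff)
  then have "a < m \<or> b < m" using assms(2) mult_le_mono[of m a m b] by (meson leD leI)
  then show False using assms(3)[of a] assms(3)[of b] ab by auto
qed

lemma card_primes_upto_ge_filter:
  "length (filter (\<lambda>p. p \<le> N) primes_below_200) \<le> card (primes_upto_set N)"
proof (rule card_primes_upto_ge_length)
  have "sorted_wrt (<) primes_below_200" by (simp add: primes_below_200_def)
  then show "sorted_wrt (<) (filter (\<lambda>p. p \<le> N) primes_below_200)" by (rule sorted_wrt_filter)
  \<comment> \<open>All entries are below \<open>17 * 17 = 289\<close>, so divisors below 17
    suffice.\<close>
  have "list_all (\<lambda>p. 1 < p \<and> p < 17 * 17 \<and> list_all (\<lambda>q. q dvd p \<longrightarrow> q = p) [2..<17]) primes_below_200"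
    by (simp add: primes_below_200_def upt_rec_numeral)
  then have "list_all Factorial_Ring.prime primes_below_200"
    unfolding list_all_iff set_upt by (auto intro!: prime_natI_small_divisors[of _ 17])
  then show "list_all (\<lambda>p. Factorial_Ring.prime p \<and> p \<le> N) (filter (\<lambda>p. p \<le> N) primes_below_200)"
    by (simp add: list_all_iff)
qed

text \<open>True prime counts for the early rounds: the Chebyshev bound falls short of them, and it
  starts only at \<open>N = 9\<close>.\<close>

lemma card_primes_upto_small:
  shows "4 \<le> card (primes_upto_set 7)"
  and "5 \<le> card (primes_upto_set 11)"
  and "8 \<le> card (primes_upto_set 19)"
  and "15 \<le> card (primes_upto_set 47)"
  and "25 \<le> card (primes_upto_set 97)"
  and "37 \<le> card (primes_upto_set 157)"
  and "11 \<le> card (primes_upto_set 31)"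
  and "14 \<le> card (primes_upto_set 43)"
  and "21 \<le> card (primes_upto_set 73)"
  and "42 \<le> card (primes_upto_set 181)"
  and "31 \<le> card (primes_upto_set 127)"
  and "46 \<le> card (primes_upto_set 199)"
proof -
  show "4 \<le> card (primes_upto_set 7)"
    using card_primes_upto_ge_filter[of 7] by (simp add: primes_below_200_def)
  show "5 \<le> card (primes_upto_set 11)"
    using card_primes_upto_ge_filter[of 11] by (simp add: primes_below_200_def)
  show "8 \<le> card (primes_upto_set 19)"
    using card_primes_upto_ge_filter[of 19] by (simp add: primes_below_200_def)
  show "15 \<le> card (primes_upto_set 47)"
    using card_primes_upto_ge_filter[of 47] by (simp add: primes_below_200_def)
  show "25 \<le> card (primes_upto_set 97)"
    using card_primes_upto_ge_filter[of 97] by (simp add: primes_below_200_def)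
  show "37 \<le> card (primes_upto_set 157)"
    using card_primes_upto_ge_filter[of 157] by (simp add: primes_below_200_def)
  show "11 \<le> card (primes_upto_set 31)"
    using card_primes_upto_ge_filter[of 31] by (simp add: primes_below_200_def)
  show "14 \<le> card (primes_upto_set 43)"
    using card_primes_upto_ge_filter[of 43] by (simp add: primes_below_200_def)
  show "21 \<le> card (primes_upto_set 73)"
    using card_primes_upto_ge_filter[of 73] by (simp add: primes_below_200_def)
  show "42 \<le> card (primes_upto_set 181)"
    using card_primes_upto_ge_filter[of 181] by (simp add: primes_below_200_def)
  show "31 \<le> card (primes_upto_set 127)"
    using card_primes_upto_ge_filter[of 127] by (simp add: primes_below_200_def)
  show "46 \<le> card (primes_upto_set 199)"
    using card_primes_upto_ge_filter[of 199] by (simp add: primes_below_200_def)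
qed

text \<open>For \<open>N = 3 * 2 ^ k\<close> the logarithm is estimated by \<open>3 ^ 5 \<le> 2 ^ 8\<close>, that is, \<open>N ^ 5 \<le> 2 ^ (5 * k + 8)\<close>.\<close>

lemma card_primes_upto_large:
  shows "57 \<le> card (primes_upto_set 512)"
  and "80 \<le> card (primes_upto_set 768)"
  and "103 \<le> card (primes_upto_set 1024)"
  and "145 \<le> card (primes_upto_set 1536)"
  and "187 \<le> card (primes_upto_set 2048)"
  and "265 \<le> card (primes_upto_set 3072)"
  and "342 \<le> card (primes_upto_set 4096)"
  and "631 \<le> card (primes_upto_set 8192)"
  and "1171 \<le> card (primes_upto_set 16384)"
  and "1684 \<le> card (primes_upto_set 24576)"
  and "2185 \<le> card (primes_upto_set 32768)"
  and "3151 \<le> card (primes_upto_set 49152)"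
proof -
  show "57 \<le> card (primes_upto_set 512)"
    using card_primes_upto_ge[of 512 1 9] by simp
  show "80 \<le> card (primes_upto_set 768)"
    using card_primes_upto_ge[of 768 5 48] by simp
  show "103 \<le> card (primes_upto_set 1024)"
    using card_primes_upto_ge[of 1024 1 10] by simp
  show "145 \<le> card (primes_upto_set 1536)"
    using card_primes_upto_ge[of 1536 5 53] by simp
  show "187 \<le> card (primes_upto_set 2048)"
    using card_primes_upto_ge[of 2048 1 11] by simp
  show "265 \<le> card (primes_upto_set 3072)"
    using card_primes_upto_ge[of 3072 5 58] by simp
  show "342 \<le> card (primes_upto_set 4096)"
    using card_primes_upto_ge[of 4096 1 12] by simp
  show "631 \<le> card (primes_upto_set 8192)"
    using card_primes_upto_ge[of 8192 1 13] by simp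
  show "1171 \<le> card (primes_upto_set 16384)"
    using card_primes_upto_ge[of 16384 1 14] by simp
  show "1684 \<le> card (primes_upto_set 24576)"
    using card_primes_upto_ge[of 24576 5 73] by simp
  show "2185 \<le> card (primes_upto_set 32768)"
    using card_primes_upto_ge[of 32768 1 15] by simp
  show "3151 \<le> card (primes_upto_set 49152)"
    using card_primes_upto_ge[of 49152 5 78] by simp
qed

text \<open>The bootstrap starts at 7 because the choice \<open>N = 7\<close>, \<open>j = 1\<close>
  requires \<open>7 \<le> n\<close>. It ends beyond \<open>2 ^ 186\<close>, where the uniform
  argument for large \<open>n\<close> applies.\<close>

lemma small_primes_unity_range:
  assumes H: "small_primes_unity n l" and "n \<ge> 7"
  shows "2 ^ 188 \<le> n"
proof -
  \<comment> \<open>The explicit numbers after \<open>step\<close> are \<open>lam\<close>, \<open>N\<close> and \<open>j\<close>; they were found by a greedy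
    search for the largest conclusion that follows from the current lower bound for \<open>n\<close>.\<close>
  note pi = card_primes_upto_small card_primes_upto_large
  note step = small_primes_unity_step[OF H]
  note eval = lessThan_nat_numeral lessThan_Suc fact_numeral
  have *: "12 \<le> n"
    by (rule step[OF assms(2), of 2 7 1, OF _ _ _ pi(1)]) (simp_all add: eval)
  have *: "20 \<le> n"
    by (rule step[OF *, of 3 11 1, OF _ _ _ pi(2)]) (simp_all add: eval)
  have *: "56 \<le> n"
    by (rule step[OF *, of 4 19 1, OF _ _ _ pi(3)]) (simp_all add: eval)
  have *: "210 \<le> n"
    by (rule step[OF *, of 5 47 1, OF _ _ _ pi(4)]) (simp_all add: eval)
  have *: "600 \<le> n"
    by (rule step[OF *, of 7 97 1, OF _ _ _ pi(5)]) (simp_all add: eval)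
  have *: "1332 \<le> n"
    by (rule step[OF *, of 9 157 1, OF _ _ _ pi(6)]) (simp_all add: eval)
  have *: "1980 \<le> n"
    by (rule step[OF *, of 10 31 2, OF _ _ _ pi(7)]) (simp_all add: eval)
  have *: "6006 \<le> n"
    by (rule step[OF *, of 10 43 2, OF _ _ _ pi(8)]) (simp_all add: eval)
  \<comment> \<open>From here on each count is rounded down to a power of two, whose exponent is the
    next \<open>lam\<close>.\<close>
  have *: "2^15 \<le> n"
    by (rule step[OF *, of 12 73 2, OF _ _ _ pi(9)]) (simp_all add: eval)
  have *: "2^19 \<le> n"
    by (rule step[OF *, of 15 181 2, OF _ _ _ pi(10)]) (simp_all add: eval)
  have *: "2^21 \<le> n"
    by (rule step[OF *, of 19 512 2, OF _ _ _ pi(13)]) (simp_all add: eval)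
  have *: "2^23 \<le> n"
    by (rule step[OF *, of 21 127 3, OF _ _ _ pi(11)]) (simp_all add: eval)
  have *: "2^27 \<le> n"
    by (rule step[OF *, of 23 199 3, OF _ _ _ pi(12)]) (simp_all add: eval)
  have *: "2^29 \<le> n"
    by (rule step[OF *, of 27 512 3, OF _ _ _ pi(13)]) (simp_all add: eval)
  have *: "2^32 \<le> n"
    by (rule step[OF *, of 29 768 3, OF _ _ _ pi(14)]) (simp_all add: eval)
  have *: "2^37 \<le> n"
    by (rule step[OF *, of 32 1536 3, OF _ _ _ pi(16)]) (simp_all add: eval)
  have *: "2^39 \<le> n"
    by (rule step[OF *, of 37 2048 3, OF _ _ _ pi(17)]) (simp_all add: eval)
  have *: "2^40 \<le> n"
    by (rule step[OF *, of 39 768 4, OF _ _ _ pi(14)]) (simp_all add: eval)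
  have *: "2^43 \<le> n"
    by (rule step[OF *, of 40 1024 4, OF _ _ _ pi(15)]) (simp_all add: eval)
  have *: "2^47 \<le> n"
    by (rule step[OF *, of 43 1536 4, OF _ _ _ pi(16)]) (simp_all add: eval)
  have *: "2^55 \<le> n"
    by (rule step[OF *, of 47 3072 4, OF _ _ _ pi(18)]) (simp_all add: eval)
  have *: "2^61 \<le> n"
    by (rule step[OF *, of 55 2048 5, OF _ _ _ pi(17)]) (simp_all add: eval)
  have *: "2^70 \<le> n"
    by (rule step[OF *, of 61 4096 5, OF _ _ _ pi(19)]) (simp_all add: eval)
  have *: "2^79 \<le> n"
    by (rule step[OF *, of 70 8192 5, OF _ _ _ pi(20)]) (simp_all add: eval)
  have *: "2^92 \<le> n"
    by (rule step[OF *, of 79 8192 6, OF _ _ _ pi(20)]) (simp_all add: eval)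
  have *: "2^105 \<le> n"
    by (rule step[OF *, of 92 8192 7, OF _ _ _ pi(20)]) (simp_all add: eval)
  have *: "2^117 \<le> n"
    by (rule step[OF *, of 105 16384 7, OF _ _ _ pi(21)]) (simp_all add: eval)
  have *: "2^140 \<le> n"
    by (rule step[OF *, of 117 24576 8, OF _ _ _ pi(22)]) (simp_all add: eval)
  have *: "2^162 \<le> n"
    by (rule step[OF *, of 140 32768 9, OF _ _ _ pi(23)]) (simp_all add: eval)
  have *: "2^188 \<le> n"
    by (rule step[OF *, of 162 49152 10, OF _ _ _ pi(24)]) (simp_all add: eval)
  show ?thesis by (rule *)
qed

section \<open>Uniform estimates for large \<open>n\<close>, and the exclusion of all
  \<open>n\<close>\<close>

lemma square_le_two_power:
  fixes s :: nat
  assumes "16 \<le> s"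
  shows "256 * s\<^sup>2 \<le> 2 ^ s"
  using assms
proof (induction s rule: nat_induct_at_least)
  case (Suc s)
  have "16 * s \<le> s * s" using Suc.hyps by (rule mult_le_mono1)
  moreover have "(Suc s)\<^sup>2 = s * s + 2 * s + 1" by (simp add: power2_eq_square)
  ultimately have "(Suc s)\<^sup>2 \<le> 2 * s\<^sup>2" using Suc.hyps unfolding power2_eq_square by linarith
  with Suc.IH show ?case by simp
qed simp

text \<open>Each step multiplies the left side by at most 49/25 and the right side by 2. It serves
  to show that \<open>j\<close> is not too small compared with \<open>s\<close>; the constant is
  \<open>1210 = 10 * 11\<^sup>2\<close>.\<close>

lemma quartic_le_two_power:
  fixes s :: nat
  assumes "16 \<le> s"
  shows "19 * (7 * s\<^sup>2 + 11 * s)\<^sup>2 \<le> 1210 * 2 ^ s"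
  using assms
proof (induction s rule: nat_induct_at_least)
  case (Suc s)
  obtain t where t: "s = 16 + t" using Suc.hyps le_Suc_ex by blast
  have "5 * (7 * (Suc s)\<^sup>2 + 11 * Suc s) \<le> 7 * (7 * s\<^sup>2 + 11 * s)"
    unfolding t by (simp add: power2_eq_square algebra_simps)
  then have "(5 * (7 * (Suc s)\<^sup>2 + 11 * Suc s))\<^sup>2 \<le> (7 * (7 * s\<^sup>2 + 11 * s))\<^sup>2"
    by (rule power_mono) simp
  then have "25 * (7 * (Suc s)\<^sup>2 + 11 * Suc s)\<^sup>2 \<le> 49 * (7 * s\<^sup>2 + 11 * s)\<^sup>2"
    unfolding power_mult_distrib by simp
  with Suc.IH show ?case unfolding power_Suc by linarith
qed simp

text \<open>From \<open>j\<close> to \<open>j + 1\<close> the left side gains the factor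
  \<open>2 * (j + 1)\<close>. The right side gains at least as much, because
  \<open>(1 + 1 / (j + 1)) ^ (j + 1)\<close> is at least 2 by Bernoulli.\<close>

lemma two_power_mult_fact_le: "2 ^ j * fact j \<le> (j + 1) ^ j"
proof (induction j)
  case (Suc j)
  have "2 * (j + 1) ^ Suc j \<le> (Suc j + 1) ^ Suc j"
  proof -
    have "1 + real (Suc j) * (1 / real (j + 1)) \<le> (1 + 1 / real (j + 1)) ^ Suc j"
      by (rule Bernoulli_inequality) (simp add: field_simps)
    then have "2 \<le> (real (j + 2) / real (j + 1)) ^ Suc j"
      by (simp add: field_simps)
    then have "2 * real (j + 1) ^ Suc j \<le> real (j + 2) ^ Suc j"
      unfolding power_divide by (subst (asm) pos_le_divide_eq) (simp_all del: power_Suc)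
    then have "real (2 * (j + 1) ^ Suc j) \<le> real ((j + 2) ^ Suc j)"
      by (simp only: of_nat_mult of_nat_power of_nat_numeral)
    then have "2 * (j + 1) ^ Suc j \<le> (j + 2) ^ Suc j" by (simp only: of_nat_le_iff)
    then show ?thesis by (simp del: power_Suc)
  qed
  moreover have "2 ^ Suc j * fact (Suc j) = 2 * (j + 1) * (2 ^ j * fact j)" by (simp add: algebra_simps)
  moreover have "2 * (j + 1) * (2 ^ j * fact j) \<le> 2 * (j + 1) * (j + 1) ^ j"
    using Suc.IH by (rule mult_le_mono2)
  ultimately show ?case by (simp add: mult.assoc)
qed simp

text \<open>The \<open>j\<close>-th root of the estimate needed for large \<open>n\<close>. With
  \<open>R = sqrt (2 ^ s)\<close> it suffices to compare square roots, where 1.733 is an upper bound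
  for \<open>sqrt 3\<close>.\<close>

lemma chebyshev_vs_binomial_base:
  fixes s j lam P :: nat
  assumes s: "16 \<le> s" and lam: "19 * lam\<^sup>2 < 20 * 2 ^ s" and j: "s * j \<le> lam" and P: "2 ^ s \<le> s * P"
  shows "3 * 2 ^ s * (j + 1)\<^sup>2 \<le> 4 * (P - 2 * j)\<^sup>2"
proof -
  define R where "R = sqrt (2 ^ s)"
  have R2: "R * R = 2 ^ s" by (simp add: R_def)
  have "(real (16 * s))\<^sup>2 \<le> 2 ^ s"
    using of_nat_mono[OF square_le_two_power[OF s], where 'a = real] by (simp add: power_mult_distrib)
  then have Rs: "16 * real s \<le> R" by (simp add: R_def real_le_rsqrt)
  then have R: "256 \<le> R" using s by simp
  have "real (19 * lam\<^sup>2) < real (20 * 2 ^ s)" using lam by (simp only: of_nat_less_iff)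
  then have "19 * (real lam)\<^sup>2 < 20 * (R * R)" by (simp add: R2)
  \<comment> \<open>The constant 1.0609 is the square of 1.03 and exceeds 20/19.\<close>
  then have "(real lam)\<^sup>2 \<le> 10609 / 10000 * (R * R)" using zero_le_square[of R] by linarith
  also have "\<dots> = (1.03 * R)\<^sup>2" by (simp add: power2_eq_square)
  finally have lamR: "real lam \<le> 1.03 * R" 
    by (rule power2_le_imp_le) (use R in simp)
  have jl: "real s * real j \<le> real lam" using of_nat_mono[OF j, where 'a = real] by simp
  have PR: "R * R \<le> real s * real P"
    unfolding R2 using of_nat_mono[OF P, where 'a = real] by simp
  \<comment> \<open>Multiplied by \<open>s\<close>, both sides involve \<open>j\<close> and
    \<open>P\<close> only through \<open>s * j\<close> and \<open>s * P\<close>, which are bounded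
    in terms of \<open>R\<close>.\<close>
  have "real s * (1.733 * R * (real j + 1)) = 1.733 * R * (real s * real j) + 1.733 * R * real s"
    by (simp add: algebra_simps)
  also have "\<dots> \<le> 1.733 * R * (1.03 * R) + 1.733 * R * (R / 16)"
    using jl lamR Rs R by (intro add_mono mult_left_mono) auto
  also have "\<dots> \<le> 1.9 * (R * R)" using R by (simp add: algebra_simps)
  also have "\<dots> \<le> 2 * (R * R) - 4 * (1.03 * R)"
    using mult_right_mono[OF R, of R] R by simp
  also have "\<dots> \<le> 2 * (real s * real P) - 4 * (real s * real j)"
    using PR jl lamR by linarith
  also have "\<dots> = real s * (2 * (real P - 2 * real j))" by (simp add: algebra_simps)
  finally have main: "1.733 * R * (real j + 1) \<le> 2 * (real P - 2 * real j)"
    using s by simp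
  \<comment> \<open>Positivity yields \<open>2 * j \<le> P\<close>, so the natural subtraction in
    the claim is not truncated.\<close>
  have "0 \<le> 1.733 * R * (real j + 1)" using R by simp
  then have "0 \<le> 2 * (real P - 2 * real j)" using main by (rule order_trans)
  then have "real (2 * j) \<le> real P" by simp
  then have "2 * j \<le> P" by (simp only: of_nat_le_iff)
  then have PJ: "real P - 2 * real j = real (P - 2 * j)" by (simp add: of_nat_diff)
  have "real (3 * 2 ^ s * (j + 1)\<^sup>2) = 3 * (R * R * (real j + 1)\<^sup>2)"
    by (simp add: R2)
  also have "\<dots> \<le> 3.003289 * (R * R * (real j + 1)\<^sup>2)"
    by (intro mult_right_mono) simp_all
  also have "\<dots> = (1.733 * R * (real j + 1))\<^sup>2"
    by (simp add: power2_eq_square)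
  also have "\<dots> \<le> (2 * (real P - 2 * real j))\<^sup>2"
    using main R by (intro power_mono) simp_all
  also have "\<dots> = real (4 * (P - 2 * j)\<^sup>2)"
    unfolding PJ by (simp add: power_mult_distrib)
  finally show ?thesis by (simp only: of_nat_le_iff)
qed

text \<open>
  Here \<open>N = 2 ^ s\<close> is the largest power of two that the bound \<open>N \<le> 4 + 19/10 lam\<^sup>2\<close> safely admits, and \<open>j\<close> is maximal
  with \<open>N ^ j \<le> 2 ^ lam\<close>. The preceding lemma shows that the number of quotients is at least
  \<open>(3 N) ^ j\<close>, and \<open>3 ^ j \<ge> N\<close>.
\<close>

lemma not_small_primes_unity_large:
  assumes "small_primes_unity n l"
  shows "n < 2 ^ 186"
proof (rule ccontr)
  assume "\<not> n < 2 ^ 186"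
  then have n: "2 ^ 186 \<le> n" by simp
  then have "1 \<le> n" by (rule order_trans[rotated]) simp
  then obtain lam where lam: "2 ^ lam \<le> n" "n < 2 ^ (lam + 1)"
    using ex_power_ivl1[of 2 n] by auto
  have "2 ^ 186 < (2 :: nat) ^ (lam + 1)" using n lam(2) by (rule le_less_trans)
  then have "186 < lam + 1" by (rule power_less_imp_less_exp[rotated]) simp
  then have lam_ge: "186 \<le> lam" by simp
  \<comment> \<open>186 is the least \<open>lam\<close> for which
    \<open>19 * lam\<^sup>2 / 10\<close> reaches \<open>65536 = 2 ^ 16\<close>, and thus
    \<open>s \<ge> 16\<close>.\<close>
  then have "186\<^sup>2 \<le> lam\<^sup>2" by (rule power_mono) simp
  then have "65536 \<le> 19 * lam\<^sup>2 div 10" by simp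
  then obtain s where s: "2 ^ s \<le> 19 * lam\<^sup>2 div 10" "19 * lam\<^sup>2 div 10 < 2 ^ (s + 1)"
    using ex_power_ivl1[of 2 "19 * lam\<^sup>2 div 10"] by auto
  have "2 ^ 16 < (2 :: nat) ^ (s + 1)"
    using \<open>65536 \<le> 19 * lam\<^sup>2 div 10\<close> s(2) by simp
  then have "16 < s + 1" by (rule power_less_imp_less_exp[rotated]) simp
  then have s16: "16 \<le> s" by simp
  have s_le: "10 * 2 ^ s \<le> 19 * lam\<^sup>2" and s_gt: "19 * lam\<^sup>2 < 20 * 2 ^ s"
    using s by (simp_all add: less_mult_imp_div_less div_less_iff_less_mult less_eq_div_iff_mult_less_eq)
  define j where "j = lam div s"
  have j: "s * j \<le> lam" "lam < s * (j + 1)"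
    using s16 dividend_less_times_div[of s lam] by (simp_all add: j_def)
  define P where "P = card (primes_upto_set (2 ^ s))"
  have "(2 :: nat) ^ 16 \<le> 2 ^ s" using s16 by (intro power_increasing) simp_all
  then have P: "2 ^ s \<le> s * P"
    using card_primes_upto_ge[of "2 ^ s" 1 s] by (simp add: P_def)
  \<comment> \<open>Since \<open>2 ^ 11 \<le> 3 ^ 7\<close>, this ratio is enough for
    \<open>2 ^ s \<le> 3 ^ j\<close>.\<close>
  have "7 * s \<le> 11 * j"
  proof (rule ccontr)
    assume "\<not> 7 * s \<le> 11 * j"
    then have "11 * (j + 1) \<le> 7 * s + 10" by simp
    then have "s * (11 * (j + 1)) \<le> s * (7 * s + 10)" by (rule mult_le_mono2)
    moreover have "11 * lam < 11 * (s * (j + 1))" using j(2) by simp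
    ultimately have "11 * lam < 7 * s\<^sup>2 + 11 * s"
      by (simp add: power2_eq_square algebra_simps)
    then have "(11 * lam)\<^sup>2 < (7 * s\<^sup>2 + 11 * s)\<^sup>2" by (rule power_strict_mono) simp_all
    then have "19 * (11 * lam)\<^sup>2 < 1210 * 2 ^ s" using quartic_le_two_power[OF s16] by linarith
    then show False using s_le by (simp add: power_mult_distrib)
  qed
  have "((2 :: nat) ^ s) ^ 11 = (2 ^ 11) ^ s" by (simp only: power_mult[symmetric] mult.commute)
  also have "\<dots> \<le> (3 ^ 7) ^ s" by (rule power_mono) simp_all
  also have "\<dots> = 3 ^ (7 * s)" by (rule power_mult[symmetric])
  also have "\<dots> \<le> 3 ^ (11 * j)" using \<open>7 * s \<le> 11 * j\<close> by (rule power_increasing) simp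
  also have "\<dots> = (3 ^ j) ^ 11" by (simp only: power_mult[symmetric] mult.commute)
  finally have three: "(2 :: nat) ^ s \<le> 3 ^ j" by (rule power_le_imp_le_base[of _ 10, simplified]) simp
  \<comment> \<open>By maximality of \<open>j\<close>, this number is at least
    \<open>2 ^ (lam + 1)\<close> and so exceeds \<open>n\<close>; as a lower bound for
    \<open>n\<close> it gives the contradiction.\<close>
  let ?c = "2 ^ (s * (j + 1)) :: nat"
  have four: "(4 :: nat) ^ j = (2 ^ j)\<^sup>2" by (simp add: power2_eq_square flip: power_mult_distrib)
  \<comment> \<open>The factor \<open>4 ^ j\<close> pairs with the factorials to allow
    \<open>two_power_mult_fact_le\<close>. The surplus \<open>2 ^ s\<close> in \<open>?c\<close> is
    absorbed by \<open>3 ^ j\<close>, so that a pure \<open>j\<close>-th power remains.\<close>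
  have "?c * (fact j)\<^sup>2 * 4 ^ j = ?c * (2 ^ j * fact j)\<^sup>2"
    by (simp add: four power_mult_distrib mult_ac)
  also have "\<dots> \<le> ?c * ((j + 1) ^ j)\<^sup>2"
    by (intro mult_le_mono2 power_mono two_power_mult_fact_le) simp
  also have "\<dots> = 2 ^ s * (2 ^ s) ^ j * ((j + 1) ^ j)\<^sup>2" by (simp add: power_add power_mult)
  also have "\<dots> \<le> 3 ^ j * (2 ^ s) ^ j * ((j + 1) ^ j)\<^sup>2"
    using three by (intro mult_le_mono1)
  also have "\<dots> = (3 * 2 ^ s * (j + 1)\<^sup>2) ^ j"
    by (simp only: power_mult_distrib power_commutes power_mult[symmetric] mult.commute[of j 2])
  also have "\<dots> \<le> (4 * (P - 2 * j)\<^sup>2) ^ j"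
    by (intro power_mono chebyshev_vs_binomial_base[OF s16 s_gt j(1) P]) simp
  also have "\<dots> = (P - 2 * j) ^ j * (P - 2 * j) ^ j * 4 ^ j"
    by (simp add: power_mult_distrib power2_eq_square)
  also have "\<dots> \<le> (\<Prod>i<j. P - i) * (\<Prod>i<j. P - j - i) * 4 ^ j"
  proof (intro mult_le_mono mult_le_mono1)
    have "(\<Prod>i<j. P - 2 * j) \<le> (\<Prod>i<j. P - i)" by (intro prod_mono) auto
    then show "(P - 2 * j) ^ j \<le> (\<Prod>i<j. P - i)" by simp
    have "(\<Prod>i<j. P - 2 * j) \<le> (\<Prod>i<j. P - j - i)" by (intro prod_mono) auto
    then show "(P - 2 * j) ^ j \<le> (\<Prod>i<j. P - j - i)" by simp
  qed simp
  finally have "?c * (fact j)\<^sup>2 \<le> (\<Prod>i<j. P - i) * (\<Prod>i<j. P - j - i)" by simp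
  then have "?c \<le> n"
  proof (rule small_primes_unity_step[OF assms order_refl lam(1), rotated 3])
    have "(2 ^ s) ^ j \<le> (2 :: nat) ^ lam"
      unfolding power_mult[symmetric] using j(1) by (intro power_increasing) simp_all
    then show "(2 ^ s) ^ j \<le> n" using lam(1) by (rule order_trans)
  qed (use s_le in \<open>simp_all add: P_def\<close>)
  moreover have "2 ^ (lam + 1) \<le> ?c" using j(2) by (intro power_increasing) simp_all
  ultimately show False using lam(2) by linarith
qed

text \<open>For \<open>n \<ge> 7\<close> the two preceding bounds contradict each other. For smaller
  \<open>n\<close> the primes 2 and 3 always lie below the bound, so \<open>l\<close> divides
  \<open>gcd (2 ^ n - 1) (3 ^ n - 1)\<close>, which direct evaluation shows to be at most
  \<open>n\<^sup>2\<close>.\<close>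

lemma not_small_primes_unity: "\<not> small_primes_unity n l"
proof
  assume H: "small_primes_unity n l"
  then have n: "n > 0" "n\<^sup>2 < l" by (simp_all add: small_primes_unity_def)
  have root: "l dvd p ^ n - 1" if "Factorial_Ring.prime p" "p \<le> 4" for p
  proof -
    have "real p \<le> 4" using that(2) by simp
    also have "4 \<le> 4 * (1 + (ln (real n))\<^sup>2)" by simp
    finally have "real p \<le> 4 * (1 + (ln (real n))\<^sup>2)" .
    then have "[p ^ n = 1] (mod l)" using H that by (simp add: small_primes_unity_def)
    then show ?thesis by (rule cong_to_1_nat)
  qed
  have "l dvd 2 ^ n - 1" "l dvd 3 ^ n - 1" using root[of 2] root[of 3] by simp_all
  then have "l dvd gcd (2 ^ n - 1) (3 ^ n - 1)" by (rule gcd_greatest)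
  moreover have "2 ^ n - 1 \<noteq> (0 :: nat)" using one_less_power[of "2 :: nat" n] n(1) by simp
  then have "gcd (2 ^ n - 1) (3 ^ n - 1 :: nat) > 0" unfolding gcd_pos_nat by blast
  ultimately have le: "l \<le> gcd (2 ^ n - 1) (3 ^ n - 1)" by (rule dvd_imp_le)
  show False
  proof (cases "n < 7")
    case True
    then have "n \<in> {1, 2, 3, 4, 5, 6}" using n(1) by auto
    then have "gcd (2 ^ n - 1) (3 ^ n - 1) \<le> n\<^sup>2"
      by (elim insertE emptyE) (simp_all add: gcd_non_0_nat)
    then show False using le n by linarith
  next
    case False
    then have "2 ^ 188 \<le> n" using small_primes_unity_range[OF H] by simp
    moreover have "n < 2 ^ 186" using H by (rule not_small_primes_unity_large)
    ultimately show False by simp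
  qed
qed

theorem theorem1p7:
  fixes A :: "('a, 'b) ring_scheme" and n l :: nat
  assumes "order_of_rank A n"
    and "n \<ge> 1"
    and "Factorial_Ring.prime l"
    and "l > n ^ 2"
  shows "\<exists>P. maximalideal P A \<and>
           (\<exists>p::nat. Factorial_Ring.prime p \<and> real p \<le> 4 * (1 + (ln (real n)) ^ 2) \<and> add_pow A p \<one>\<^bsub>A\<^esub> \<in> P) \<and>
           \<not> [card (carrier (A Quot P)) = 1] (mod l)"
proof (rule ccontr)
  let ?goal = "\<exists>P. maximalideal P A \<and>
    (\<exists>p::nat. Factorial_Ring.prime p \<and> real p \<le> 4 * (1 + (ln (real n)) ^ 2) \<and> add_pow A p \<one>\<^bsub>A\<^esub> \<in> P) \<and>
    \<not> [card (carrier (A Quot P)) = 1] (mod l)"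
  assume no: "\<not> ?goal"
  have "[p ^ n = 1] (mod l)"
    if p: "Factorial_Ring.prime p" "real p \<le> 4 * (1 + (ln (real n)) ^ 2)" for p
  proof (rule prime_power_rank_cong_one[OF assms(1)])
    show "p > 0" using p(1) by (rule prime_gt_0_nat)
    show "[card (carrier (A Quot M)) = 1] (mod l)"
      if "maximalideal M A" "add_pow A p \<one>\<^bsub>A\<^esub> \<in> M" for M
    proof (rule ccontr)
      assume "\<not> [card (carrier (A Quot M)) = 1] (mod l)"
      with p that have ?goal by (intro exI[of _ M] exI[of _ p] conjI)
      with no show False ..
    qed
  qed
  then have "small_primes_unity n l"
    using assms(2-4) by (simp add: small_primes_unity_def)
  then show False using not_small_primes_unity by (rule notE[rotated])
qed

end
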